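(* Let $N\ge 1$ and let $z_1> z_2>\dots> z_N$ be the zeros of the classical Hermite polynomial $H_N$ (orthogonal with respect to the weight $e^{-x^2}$ on $\mathbb R$), and put ${\bf z}:=(z_1,\dots,z_N)$. For $k\ge0$ let $(X_{t,k})_{t\ge0}$ be the Bessel process of type $A_{N-1}$ with multiplicity $k$ on $C_N^A$, started in $0\in C_N^A$. Define the matrix $S=(s_{i,j})_{i,j=1,\dots,N}$ by $$s_{i,i}:=1+\sum_{l\ne i}(z_i-z_l)^{-2},\qquad s_{i,j}:=-(z_i-z_j)^{-2}\quad (i\ne j).$$ Then $S$ is invertible, and for every $t>0$, with $\Sigma:=S^{-1}$, $$X_{t,k}-\sqrt{2kt}\,{\bf z}\ \longrightarrow\ N(0,t\Sigma)\qquad\text{in distribution as }k\to\infty,$$ where $N(0,t\Sigma)$ is the centered $N$-dimensional normal distribution with covariance matrix $t\Sigma$ (equivalently, $X_{t,k}/\sqrt t-\sqrt{2k}\,{\bf z}\to N(0,\Sigma)$).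
   Context: $C_N^A:=\{x\in\mathbb R^N: x_1\ge x_2\ge\dots\ge x_N\}$. For $k\ge 0$, the Bessel process of type $A_{N-1}$ with multiplicity $k$ is the diffusion on $C_N^A$ with reflecting boundary whose generator is $Lf=\frac12\Delta f+k\sum_{i=1}^N\big(\sum_{j\ne i}\frac{1}{x_i-x_j}\big)\frac{\partial f}{\partial x_i}$ with domain the restrictions to $C_N^A$ of $C^2$ functions on $\mathbb R^N$ invariant under all permutations of coordinates. Started in $0$, $X_{t,k}$ has Lebesgue density on $C_N^A$ proportional to $e^{-\|y\|^2/(2t)}\prod_{i<j}(y_i-y_j)^{2k}$. *)

theory Defs
  imports "HOL-Analysis.Analysis" "HOL-Computational_Algebra.Polynomial"
begin

text \<open>Classical (physicists') Hermite polynomials, orthogonal w.r.t. exp(-x^2):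
  H_0 = 1, H_1 = 2x, H_(n+2) = 2x H_(n+1) - 2(n+1) H_n.\<close>
fun hermite_poly :: "nat \<Rightarrow> real poly" where
  "hermite_poly 0 = 1"
| "hermite_poly (Suc 0) = [:0, 2:]"
| "hermite_poly (Suc (Suc n)) =
     [:0, 2:] * hermite_poly (Suc n) - smult (2 * real (Suc n)) (hermite_poly n)"

definition weyl_chamber_A :: "(real ^ 'n::{finite,linorder}) set" where
  "weyl_chamber_A = {x. \<forall>i j. i \<le> j \<longrightarrow> x $ j \<le> x $ i}"

text \<open>Unnormalized density of X_(t,k) (Bessel process of type A_(N-1), multiplicity k,
  started in 0) on C_N^A.\<close>
definition bessel_A_weight :: "real \<Rightarrow> real \<Rightarrow> real ^ 'n::{finite,linorder} \<Rightarrow> real" where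
  "bessel_A_weight t k y =
     indicator weyl_chamber_A y * exp (- (norm y)\<^sup>2 / (2 * t)) *
     (\<Prod>p\<in>{(i,j). i < j}. ((y $ fst p - y $ snd p)\<^sup>2) powr k)"

definition bessel_A_law :: "real \<Rightarrow> real \<Rightarrow> (real ^ 'n::{finite,linorder}) measure" where
  "bessel_A_law t k =
     density lborel (\<lambda>y. ennreal (bessel_A_weight t k y / integral\<^sup>L lborel (bessel_A_weight t k :: real ^ 'n::{finite,linorder} \<Rightarrow> real)))"

definition normal_vec_law :: "real ^ 'n ^ 'n \<Rightarrow> (real ^ 'n::finite) measure" where
  "normal_vec_law C =
     density lborel (\<lambda>x. ennreal (exp (- (x \<bullet> (matrix_inv C *v x)) / 2) /
                                  sqrt ((2 * pi) ^ CARD('n) * det C)))"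

definition weak_conv_along :: "'b filter \<Rightarrow> ('b \<Rightarrow> ('a::topological_space) measure) \<Rightarrow> 'a measure \<Rightarrow> bool" where
  "weak_conv_along F M \<mu> \<longleftrightarrow>
     (\<forall>f :: 'a \<Rightarrow> real. continuous_on UNIV f \<and> bounded (range f) \<longrightarrow>
        ((\<lambda>k. \<integral>x. f x \<partial>(M k)) \<longlongrightarrow> (\<integral>x. f x \<partial>\<mu>)) F)"

end

theory Submission
  imports Defs "HOL-Probability.Probability" "HOL-Real_Asymp.Real_Asymp"
begin

text \<open>
  Put \<open>c = \<surd>(2kt)\<close> and, for \<open>i < j\<close>, \<open>u\<^sub>i\<^sub>j = (y\<^sub>i - y\<^sub>j) / (z\<^sub>i - z\<^sub>j)\<close>. By the equilibrium
  relation \<open>(\<Sum>j\<noteq>i. 1 / (z\<^sub>i - z\<^sub>j)) = z\<^sub>i\<close> for Hermite zeros, the terms linear in \<open>y\<close> in the log-density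
  cancel, so the density of \<open>X - c z\<close> at \<open>y\<close> is proportional to
  \<open>exp (- |y|\<^sup>2 / 2t)\<close> times the product of the factors \<open>((1 + u\<^sub>i\<^sub>j / c) exp (- u\<^sub>i\<^sub>j / c))\<^sup>2\<^sup>k\<close>.
  On the chamber each factor lies between 0 and 1, because \<open>1 + v \<le> exp v\<close>, and it tends to
  \<open>exp (- u\<^sub>i\<^sub>j\<^sup>2 / 2t)\<close>. Dominated convergence gives the limit density \<open>exp (- y \<bullet> S y / 2t)\<close>
  together with the convergence of the normalising constants.
\<close>

section \<open>Gaussian integrals\<close>

lemma prod_Basis_cart: "(\<Prod>b\<in>(Basis :: (real^'n) set). f b) = (\<Prod>i\<in>UNIV. f (axis i 1))"
  by (simp add: Basis_vec_def UNION_singleton_eq_range prod.reindex axis_eq_axis inj_on_def)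

text \<open>Swapping coordinates maps boxes to boxes of equal volume, and \<open>lborel\<close> is
  determined by its values on boxes.\<close>

lemma nn_integral_lborel_swap:
  fixes h :: "real^'n \<Rightarrow> ennreal"
  assumes [measurable]: "h \<in> borel_measurable borel"
  shows "(\<integral>\<^sup>+x. h (\<chi> i. x $ Transposition.transpose m n i) \<partial>lborel) = (\<integral>\<^sup>+x. h x \<partial>lborel)"
proof -
  let ?s = "Transposition.transpose m n"
  let ?T = "\<lambda>x::real^'n. \<chi> i. x $ ?s i"
  have T_lin: "linear ?T" by (rule linearI) (simp_all add: vec_eq_iff)
  have T_meas [measurable]: "?T \<in> borel_measurable borel"
    by (intro borel_measurable_continuous_onI linear_continuous_on linear_conv_bounded_linear[THEN iffD1] T_lin)
  have "lborel = distr lborel borel ?T"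
  proof (rule lborel_eqI)
    fix l u :: "real^'n" assume le: "\<And>b. b \<in> Basis \<Longrightarrow> l \<bullet> b \<le> u \<bullet> b"
    have le': "l $ i \<le> u $ i" for i using le[of "axis i 1"] by (simp add: inner_axis)
    have pre: "?T -` box l u = box (?T l) (?T u)"
      by (auto simp: mem_box_cart) (metis transpose_involutory)+
    have "emeasure (distr lborel borel ?T) (box l u) = emeasure lborel (box (?T l) (?T u))"
      by (subst emeasure_distr) (auto simp: pre)
    also have "\<dots> = (\<Prod>b\<in>Basis. (?T u - ?T l) \<bullet> b)"
      by (rule emeasure_lborel_box) (auto simp: Basis_vec_def inner_axis le')
    also have "(\<Prod>b\<in>Basis. (?T u - ?T l) \<bullet> b) = (\<Prod>i\<in>UNIV. (u - l) $ ?s i)"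
      by (simp add: prod_Basis_cart inner_axis)
    also have "\<dots> = (\<Prod>i\<in>UNIV. (u - l) $ i)"
      by (rule prod.reindex_bij_betw) simp
    also have "\<dots> = (\<Prod>b\<in>Basis. (u - l) \<bullet> b)"
      by (simp add: prod_Basis_cart inner_axis)
    finally show "emeasure (distr lborel borel ?T) (box l u) = (\<Prod>b\<in>Basis. (u - l) \<bullet> b)" .
  qed simp
  then have "(\<integral>\<^sup>+x. h x \<partial>lborel) = (\<integral>\<^sup>+x. h x \<partial>distr lborel borel ?T)" by simp
  also have "\<dots> = (\<integral>\<^sup>+x. h (?T x) \<partial>lborel)" by (rule nn_integral_distr) auto
  finally show ?thesis by simp
qed

lemma nn_integral_lborel_stretch:
  fixes h :: "real^'n \<Rightarrow> ennreal"
  assumes [measurable]: "h \<in> borel_measurable borel" and c: "\<And>i. c i \<noteq> 0"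
  shows "ennreal \<bar>prod c UNIV\<bar> * (\<integral>\<^sup>+x. h (\<chi> i. c i * x $ i) \<partial>lborel) = (\<integral>\<^sup>+x. h x \<partial>lborel)"
proof -
  let ?c = "\<lambda>j. (\<chi> i. c i) \<bullet> j"
  let ?T = "\<lambda>x. 0 + (\<Sum>j\<in>Basis. (?c j * (x \<bullet> j)) *\<^sub>R j) :: real^'n"
  have nz: "?c j \<noteq> 0" if "j \<in> Basis" for j
    using that c by (auto simp: Basis_vec_def inner_axis)
  have T: "?T x = (\<chi> i. c i * x $ i)" for x
  proof -
    have "?T x \<bullet> j = (\<chi> i. c i * x $ i) \<bullet> j" if "j \<in> Basis" for j
      using that by (auto simp: inner_sum_left inner_Basis if_distrib sum.delta cong: if_cong)
        (auto simp: Basis_vec_def inner_axis)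
    then show "?T x = (\<chi> i. c i * x $ i)" by (rule euclidean_eqI)
  qed
  have [measurable]: "?T \<in> borel_measurable borel" by simp
  have "(\<integral>\<^sup>+x. h x \<partial>lborel) = (\<integral>\<^sup>+x. h x \<partial>density (distr lborel borel ?T) (\<lambda>_. (\<Prod>j\<in>Basis. \<bar>?c j\<bar>)))"
    using lborel_affine_euclidean[where c="?c" and t=0, OF nz] by simp
  also have "\<dots> = ennreal (\<Prod>j\<in>Basis. \<bar>?c j\<bar>) * (\<integral>\<^sup>+x. h (?T x) \<partial>lborel)"
    by (subst nn_integral_density) (simp_all add: nn_integral_cmult nn_integral_distr)
  also have "(\<Prod>j\<in>(Basis::(real^'n) set). \<bar>?c j\<bar>) = \<bar>prod c UNIV\<bar>"
    by (simp add: prod_Basis_cart inner_axis abs_prod)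
  finally show ?thesis by (simp only: T)
qed

text \<open>Fubini: once all coordinates other than \<open>a\<close> are fixed, the shear is a
  translation along \<open>a\<close>, which preserves one-dimensional Lebesgue measure.\<close>

lemma nn_integral_lborel_shear:
  fixes h :: "'a::euclidean_space \<Rightarrow> ennreal"
  assumes [measurable]: "h \<in> borel_measurable borel" and "a \<in> Basis" "b \<in> Basis" "a \<noteq> b"
  shows "(\<integral>\<^sup>+x. h (x + (x \<bullet> b) *\<^sub>R a) \<partial>lborel) = (\<integral>\<^sup>+x. h x \<partial>lborel)"
proof -
  interpret product_sigma_finite "\<lambda>_::'a. lborel :: real measure" ..
  let ?v = "\<lambda>f. \<Sum>b\<in>Basis. f b *\<^sub>R (b::'a)"
  let ?P = "\<lambda>J. \<Pi>\<^sub>M b\<in>J. (lborel :: real measure)"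
  let ?J = "Basis - {a}"
  have B: "Basis = insert a ?J" using assms by auto
  have split: "(\<integral>\<^sup>+x. g x \<partial>lborel) = (\<integral>\<^sup>+w. (\<integral>\<^sup>+y. g ((\<Sum>c\<in>?J. w c *\<^sub>R c) + y *\<^sub>R a) \<partial>lborel) \<partial>?P ?J)"
    if [measurable]: "g \<in> borel_measurable borel" for g :: "'a \<Rightarrow> ennreal"
  proof -
    have "(\<integral>\<^sup>+x. g x \<partial>lborel) = (\<integral>\<^sup>+w. g (?v w) \<partial>?P Basis)"
      by (subst lborel_eq, subst nn_integral_distr) auto
    also have "\<dots> = (\<integral>\<^sup>+w. g (?v w) \<partial>?P (insert a ?J))"
      using B by simp
    also have "\<dots> = (\<integral>\<^sup>+w. (\<integral>\<^sup>+y. g (?v (w(a := y))) \<partial>lborel) \<partial>?P ?J)"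
      by (rule product_nn_integral_insert) (auto simp flip: B)
    also have "(\<lambda>w y. ?v (w(a := y))) = (\<lambda>w y. (\<Sum>c\<in>?J. w c *\<^sub>R c) + y *\<^sub>R a)"
      by (intro ext, subst B, subst sum.insert) (auto simp: algebra_simps intro!: sum.cong)
    finally show ?thesis by (simp add: fun_eq_iff)
  qed
  \<comment> \<open>Since \<open>a \<noteq> b\<close>, the amount of translation is read off from
    the outer variable \<open>w\<close> and is constant in the inner integral.\<close>
  have ba: "((\<Sum>c\<in>?J. w c *\<^sub>R c) + y *\<^sub>R a) \<bullet> b = w b" for w :: "'a \<Rightarrow> real" and y
    using assms by (simp add: inner_add_left inner_sum_left inner_Basis if_distrib sum.delta cong: if_cong)
  have shear: "x + (x \<bullet> b) *\<^sub>R a = (\<Sum>c\<in>?J. w c *\<^sub>R c) + (w b + y) *\<^sub>R a"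
    if "x = (\<Sum>c\<in>?J. w c *\<^sub>R c) + y *\<^sub>R a" for x and w :: "'a \<Rightarrow> real" and y
    unfolding that ba by (simp add: algebra_simps)
  have "(\<integral>\<^sup>+x. h (x + (x \<bullet> b) *\<^sub>R a) \<partial>lborel)
      = (\<integral>\<^sup>+w. (\<integral>\<^sup>+y. h ((\<Sum>c\<in>?J. w c *\<^sub>R c) + (w b + y) *\<^sub>R a) \<partial>lborel) \<partial>?P ?J)"
    by (subst split) (simp_all only: shear[OF refl], measurable)
  also have "\<dots> = (\<integral>\<^sup>+w. (\<integral>\<^sup>+y. h ((\<Sum>c\<in>?J. w c *\<^sub>R c) + y *\<^sub>R a) \<partial>lborel) \<partial>?P ?J)"
  proof (rule nn_integral_cong)
    fix w :: "'a \<Rightarrow> real"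
    have "(\<integral>\<^sup>+y. h ((\<Sum>c\<in>?J. w c *\<^sub>R c) + y *\<^sub>R a) \<partial>lborel)
      = (\<integral>\<^sup>+y. h ((\<Sum>c\<in>?J. w c *\<^sub>R c) + y *\<^sub>R a) \<partial>distr lborel borel ((+) (w b)))"
      by (simp only: lborel_distr_plus)
    also have "\<dots> = (\<integral>\<^sup>+y. h ((\<Sum>c\<in>?J. w c *\<^sub>R c) + (w b + y) *\<^sub>R a) \<partial>lborel)"
      by (rule nn_integral_distr) auto
    finally show "(\<integral>\<^sup>+y. h ((\<Sum>c\<in>?J. w c *\<^sub>R c) + (w b + y) *\<^sub>R a) \<partial>lborel)
       = (\<integral>\<^sup>+y. h ((\<Sum>c\<in>?J. w c *\<^sub>R c) + y *\<^sub>R a) \<partial>lborel)" ..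
  qed
  also have "\<dots> = (\<integral>\<^sup>+x. h x \<partial>lborel)" by (rule split[symmetric]) simp
  finally show ?thesis .
qed

text \<open>The change of variables theorems of HOL-Analysis require a well-ordered index type, which
  a finite linear order is not as far as type classes are concerned.\<close>
lemma nn_integral_lborel_linear:
  fixes f :: "real^'n \<Rightarrow> real^'n" and h :: "real^'n \<Rightarrow> ennreal"
  assumes "linear f" "det (matrix f) \<noteq> 0" "h \<in> borel_measurable borel"
  shows "ennreal \<bar>det (matrix f)\<bar> * (\<integral>\<^sup>+x. h (f x) \<partial>lborel) = (\<integral>\<^sup>+x. h x \<partial>lborel)"
proof -
  \<comment> \<open>The claim ranges over all \<open>h\<close> because the composition case applies
    it to \<open>h\<close> composed with \<open>f\<close>. The determinant condition sits inside the
    predicate so that maps with a vanishing coordinate satisfy it vacuously.\<close>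
  let ?P = "\<lambda>f::real^'n \<Rightarrow> real^'n. det (matrix f) \<noteq> 0 \<longrightarrow> (\<forall>h\<in>borel_measurable borel.
     ennreal \<bar>det (matrix f)\<bar> * (\<integral>\<^sup>+x. h (f x) \<partial>lborel) = (\<integral>\<^sup>+x. h x \<partial>lborel))"
  have "?P f"
  proof (rule induct_linear_elementary [OF \<open>linear f\<close>])
    fix f g :: "real^'n \<Rightarrow> real^'n"
    assume lin: "linear f" "linear g" and P: "?P f" "?P g"
    have det: "det (matrix (f \<circ> g)) = det (matrix f) * det (matrix g)"
      using lin by (simp add: matrix_compose det_mul)
    have [measurable]: "f \<in> borel_measurable borel"
      using lin by (intro borel_measurable_continuous_onI linear_continuous_on) (simp add: linear_conv_bounded_linear)
    show "?P (f \<circ> g)"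
    proof (intro impI ballI)
      fix h :: "real^'n \<Rightarrow> ennreal" assume h [measurable]: "h \<in> borel_measurable borel" and nz: "det (matrix (f \<circ> g)) \<noteq> 0"
      have "(\<integral>\<^sup>+x. h x \<partial>lborel) = ennreal \<bar>det (matrix f)\<bar> * (\<integral>\<^sup>+x. h (f x) \<partial>lborel)"
        using P(1) nz h by (simp add: det)
      also have "(\<integral>\<^sup>+x. h (f x) \<partial>lborel) = ennreal \<bar>det (matrix g)\<bar> * (\<integral>\<^sup>+x. h (f (g x)) \<partial>lborel)"
        by (rule P(2)[rule_format, symmetric, of "\<lambda>x. h (f x)"]) (use nz in \<open>auto simp: det\<close>)
      finally show "ennreal \<bar>det (matrix (f \<circ> g))\<bar> * (\<integral>\<^sup>+x. h ((f \<circ> g) x) \<partial>lborel) = (\<integral>\<^sup>+x. h x \<partial>lborel)"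
        by (simp add: det abs_mult ennreal_mult mult.assoc)
    qed
  next
    fix f :: "real^'n \<Rightarrow> real^'n" and i
    assume "linear f" and 0: "\<And>x. f x $ i = 0"
    then have "\<not> surj f"
      by (metis axis_nth surjD zero_neq_one)
    then have "det (matrix f) = 0"
      using \<open>linear f\<close> det_nz_iff_inj linear_injective_imp_surjective by blast
    then show "?P f" by simp
  next
    fix c :: "'n \<Rightarrow> real"
    let ?f = "\<lambda>x::real^'n. \<chi> i. c i * x $ i"
    have "det (matrix ?f) = prod c UNIV"
      by (simp add: axis_def matrix_def det_diagonal)
    then show "?P ?f" by (auto intro!: nn_integral_lborel_stretch)
  next
    fix m n :: 'n assume "m \<noteq> n"
    let ?f = "\<lambda>x::real^'n. \<chi> i. x $ Transposition.transpose m n i"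
    have "matrix ?f = (\<chi> i. mat 1 $ Transposition.transpose m n i)"
      by (simp add: vec_eq_iff matrix_def mat_def axis_def)
    then have "\<bar>det (matrix ?f)\<bar> = 1"
      by (simp add: det_permute_rows permutes_swap_id sign_swap_id abs_mult)
    then show "?P ?f" by (simp add: nn_integral_lborel_swap)
  next
    fix m n :: 'n assume mn: "m \<noteq> n"
    let ?f = "\<lambda>x::real^'n. \<chi> i. if i = m then x $ m + x $ n else x $ i"
    have "matrix ?f = (\<chi> k. if k = m then row m (mat 1) + 1 *s row n (mat 1) else row k (mat 1))"
      by (simp add: vec_eq_iff matrix_def mat_def axis_def row_def)
    then have "det (matrix ?f) = 1"
      using det_row_operation[OF mn, of "mat 1 :: real^'n^'n" 1] by simp
    moreover have "x + (x \<bullet> axis n 1) *\<^sub>R axis m 1 = ?f x" for x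
      by (simp add: vec_eq_iff inner_axis) (simp add: axis_def)
    ultimately show "?P ?f"
      using mn nn_integral_lborel_shear[of _ "axis m 1 :: real^'n" "axis n 1"] by (simp add: axis_eq_axis)
  qed
  then show ?thesis using assms by blast
qed

section \<open>Gaussian integrals with a positive definite quadratic form\<close>

lemma nn_integral_std_gaussian:
  "(\<integral>\<^sup>+x. ennreal (exp (- (x \<bullet> x) / 2)) \<partial>(lborel :: 'a::euclidean_space measure)) = ennreal (sqrt (2 * pi) ^ DIM('a))"
proof -
  have 1: "(\<integral>\<^sup>+x. ennreal (exp (- x\<^sup>2 / 2)) \<partial>(lborel :: real measure)) = ennreal (sqrt (2 * pi))"
  proof -
    have eq: "exp (- x\<^sup>2 / 2) = sqrt (2 * pi) * std_normal_density x" for x :: real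
      by (simp add: std_normal_density_def)
    show ?thesis unfolding eq
      by (subst nn_integral_eq_integral) auto
  qed
  have "exp (- (x \<bullet> x) / 2) = (\<Prod>b\<in>Basis. exp (- (x \<bullet> b)\<^sup>2 / 2))" for x :: 'a
    by (subst euclidean_inner) (simp add: power2_eq_square sum_divide_distrib sum_negf flip: exp_sum)
  then have "(\<integral>\<^sup>+x. ennreal (exp (- (x \<bullet> x) / 2)) \<partial>(lborel :: 'a measure))
     = (\<integral>\<^sup>+x. (\<Prod>b\<in>Basis. ennreal (exp (- (x \<bullet> b)\<^sup>2 / 2))) \<partial>(lborel :: 'a measure))"
    by (simp add: prod_ennreal)
  also have "\<dots> = (\<Prod>b\<in>(Basis :: 'a set). (\<integral>\<^sup>+x. ennreal (exp (- x\<^sup>2 / 2)) \<partial>lborel))"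
    by (rule nn_integral_lborel_prod) auto
  finally show ?thesis unfolding 1 by (simp add: ennreal_power)
qed

text \<open>Gram--Schmidt for the inner product \<open>x \<bullet> (A *v y)\<close>.\<close>
lemma posdef_congruent_identity:
  fixes A :: "real^'n^'n"
  assumes sym: "transpose A = A" and pos: "\<And>x. x \<noteq> 0 \<Longrightarrow> 0 < x \<bullet> (A *v x)"
  obtains B :: "real^'n^'n" where "transpose B ** A ** B = mat 1"
proof -
  have comm: "x \<bullet> (A *v y) = y \<bullet> (A *v x)" for x y
    by (metis dot_lmul_matrix inner_commute sym vector_transpose_matrix)
  have "\<exists>b::'n \<Rightarrow> real^'n. \<forall>i\<in>I. \<forall>j\<in>I. b i \<bullet> (A *v b j) = of_bool (i = j)" for I :: "'n set"
    using finite[of I]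
  proof (induction I)
    case empty
    show ?case by simp
  next
    case (insert k I)
    then obtain b where b: "\<forall>i\<in>I. \<forall>j\<in>I. b i \<bullet> (A *v b j) = of_bool (i = j)" by blast
    \<comment> \<open>At most \<open>card I\<close> vectors \<open>A *v b i\<close> have to be
      avoided, fewer than the dimension, so some nonzero \<open>x\<close> is orthogonal to all of
      them; rescaled, it extends the family.\<close>
    let ?V = "(\<lambda>i. A *v b i) ` I"
    have "dim ?V \<le> card I"
      by (metis card_image_le dim_le_card' finite finite_imageI order_trans)
    also have "\<dots> < card (insert k I)" using insert by simp
    also have "\<dots> \<le> CARD('n)" by (intro card_mono) auto
    finally have "dim ?V < DIM(real^'n)" by simp
    then obtain x where x: "x \<noteq> 0" "\<And>y. y \<in> span ?V \<Longrightarrow> orthogonal x y"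
      using orthogonal_to_subspace_exists by blast
    have xb: "x \<bullet> (A *v b i) = 0" if "i \<in> I" for i
      using x(2)[of "A *v b i"] that by (auto simp: orthogonal_def span_base)
    define y where "y = (1 / sqrt (x \<bullet> (A *v x))) *\<^sub>R x"
    have yy: "y \<bullet> (A *v y) = 1"
      using pos[OF x(1)] by (simp add: y_def matrix_vector_mult_scaleR)
    have yb: "y \<bullet> (A *v b i) = 0" "b i \<bullet> (A *v y) = 0" if "i \<in> I" for i
      using xb[OF that] comm[of "b i" y] by (simp_all add: y_def)
    show ?case
      using b yy yb insert.hyps by (intro exI[of _ "b(k := y)"]) auto
  qed
  from this[of UNIV] obtain b :: "'n \<Rightarrow> real^'n"
    where b: "\<And>i j. b i \<bullet> (A *v b j) = of_bool (i = j)" by auto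
  define B :: "real^'n^'n" where "B = (\<chi> i j. b j $ i)"
  have "(transpose B ** A ** B) $ i $ j = b i \<bullet> (A *v b j)" for i j
    by (simp add: B_def matrix_matrix_mult_def matrix_vector_mult_def transpose_def inner_vec_def
        sum_distrib_left sum_distrib_right mult_ac) (subst sum.swap, simp add: mult_ac)
  then have "transpose B ** A ** B = mat 1"
    by (simp add: vec_eq_iff b mat_def)
  then show ?thesis by (rule that)
qed

text \<open>Substituting \<open>B *v x\<close> for \<open>x\<close>, with \<open>B\<close> from the
  congruence of \<open>A\<close> to the identity, leaves a standard Gaussian and the Jacobian
  \<open>\<bar>det B\<bar>\<close>. Taking determinants of the congruence shows that
  \<open>det A\<close> is positive and evaluates the Jacobian.\<close>

lemma
  fixes A :: "real^'n^'n"
  assumes sym: "transpose A = A" and pos: "\<And>x. x \<noteq> 0 \<Longrightarrow> 0 < x \<bullet> (A *v x)"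
  shows det_posdef: "0 < det A"
    and nn_integral_gaussian: "(\<integral>\<^sup>+x. ennreal (exp (- (x \<bullet> (A *v x)) / 2)) \<partial>lborel)
      = ennreal (sqrt ((2 * pi) ^ CARD('n) / det A))"
proof -
  obtain B :: "real^'n^'n" where B: "transpose B ** A ** B = mat 1"
    by (rule posdef_congruent_identity[OF assms])
  have "det (transpose B ** A ** B) = 1" by (simp add: B)
  then have d: "det A * (det B)\<^sup>2 = 1"
    by (simp add: det_mul power2_eq_square mult_ac)
  then have "det A \<noteq> 0" "det B \<noteq> 0" by auto
  with d show detA: "0 < det A"
    by (metis mult_neg_pos not_less_iff_gr_or_eq not_one_less_zero zero_less_power2)
  have detB: "\<bar>det B\<bar> = sqrt (1 / det A)"
    using d detA by (intro real_sqrt_unique[symmetric]) (auto simp: field_simps)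
  have quad: "(B *v x) \<bullet> (A *v (B *v x)) = x \<bullet> x" for x
  proof -
    have "(B *v x) \<bullet> (A *v (B *v x)) = x \<bullet> ((transpose B ** A ** B) *v x)"
      by (metis dot_lmul_matrix matrix_vector_mul_assoc transpose_transpose vector_transpose_matrix)
    then show ?thesis by (simp add: B)
  qed
  have "(\<lambda>x. exp (- (x \<bullet> (A *v x)) / 2)) \<in> borel_measurable borel"
    by (intro borel_measurable_continuous_onI continuous_intros) auto
  then have meas: "(\<lambda>x. ennreal (exp (- (x \<bullet> (A *v x)) / 2))) \<in> borel_measurable borel"
    by measurable
  have "(\<integral>\<^sup>+x. ennreal (exp (- (x \<bullet> (A *v x)) / 2)) \<partial>lborel) =
     ennreal \<bar>det B\<bar> * (\<integral>\<^sup>+x. ennreal (exp (- (x \<bullet> x) / 2)) \<partial>(lborel :: (real^'n) measure))"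
    using nn_integral_lborel_linear[OF _ _ meas, of "(*v) B"] \<open>det B \<noteq> 0\<close> by (simp add: quad)
  also have "\<dots> = ennreal (sqrt ((2 * pi) ^ CARD('n) / det A))"
    unfolding nn_integral_std_gaussian detB
    using detA by (simp add: real_sqrt_divide real_sqrt_power real_sqrt_mult power_mult_distrib flip: ennreal_mult)
  finally show "(\<integral>\<^sup>+x. ennreal (exp (- (x \<bullet> (A *v x)) / 2)) \<partial>lborel)
      = ennreal (sqrt ((2 * pi) ^ CARD('n) / det A))" .
qed

section \<open>Hermite zeros\<close>

text \<open>The two identities need each other in the induction: the derivative rule turns the
  three-term recurrence into the first identity, and the first identity simplifies the derivative of
  the next polynomial.\<close>

lemma hermite_poly_Suc_and_pderiv:
  "hermite_poly (Suc n) = [:0, 2:] * hermite_poly n - pderiv (hermite_poly n) \<and>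
   pderiv (hermite_poly (Suc n)) = smult (2 * real (Suc n)) (hermite_poly n)"
proof (induction n)
  case 0
  then show ?case by (simp add: pderiv_pCons)
next
  case (Suc n)
  have R: "hermite_poly (Suc (Suc n)) = [:0, 2:] * hermite_poly (Suc n) - pderiv (hermite_poly (Suc n))"
    by (subst Suc[THEN conjunct2]) simp
  have "pderiv (hermite_poly (Suc (Suc n))) = smult 2 (hermite_poly (Suc n)) +
      smult (2 * real (Suc n)) ([:0, 2:] * hermite_poly n - pderiv (hermite_poly n))"
    by (simp add: pderiv_diff pderiv_mult pderiv_smult pderiv_pCons Suc[THEN conjunct2] smult_diff_right)
  also have "\<dots> = smult (2 * real (Suc (Suc n))) (hermite_poly (Suc n))"
    by (simp only: Suc[THEN conjunct1, symmetric]) (simp add: algebra_simps flip: smult_add_left)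
  finally show ?case using R by blast
qed

text \<open>Differentiate the first identity of \<open>hermite_poly_Suc_and_pderiv\<close> and
  compare with the second.\<close>

lemma hermite_poly_ode:
  "pderiv (pderiv (hermite_poly n)) = [:0, 2:] * pderiv (hermite_poly n) - smult (2 * real n) (hermite_poly n)"
proof -
  have "smult (2 * real (Suc n)) (hermite_poly n) = pderiv ([:0, 2:] * hermite_poly n - pderiv (hermite_poly n))"
    by (metis hermite_poly_Suc_and_pderiv)
  then have "smult (2 * real (Suc n)) (hermite_poly n) =
      smult 2 (hermite_poly n) + [:0, 2:] * pderiv (hermite_poly n) - pderiv (pderiv (hermite_poly n))"
    by (simp add: pderiv_diff pderiv_mult pderiv_pCons pderiv_smult)
  then show ?thesis by (simp add: algebra_simps smult_add_left)
qed

lemma hermite_poly_degree_coeff: "degree (hermite_poly n) \<le> n \<and> coeff (hermite_poly n) n = 2 ^ n"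
proof (induction n rule: hermite_poly.induct)
  case (3 n)
  have "degree (hermite_poly (Suc (Suc n))) \<le> Suc (Suc n)"
    unfolding hermite_poly.simps
  proof (rule degree_diff_le)
    show "degree ([:0, 2:] * hermite_poly (Suc n)) \<le> Suc (Suc n)"
      by (rule order_trans[OF degree_mult_le]) (use 3 in simp)
    show "degree (smult (2 * real (Suc n)) (hermite_poly n)) \<le> Suc (Suc n)"
      by (rule order_trans[OF degree_smult_le]) (use 3 in simp)
  qed
  moreover have "coeff (hermite_poly n) (Suc (Suc n)) = 0"
    by (rule coeff_eq_0) (use 3 in simp)
  then have "coeff (hermite_poly (Suc (Suc n))) (Suc (Suc n)) = 2 * coeff (hermite_poly (Suc n)) (Suc n)"
    by simp
  ultimately show ?case using 3 by (metis power_Suc)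
qed auto

text \<open>Stieltjes: the zeros of the Hermite polynomial are a critical point of
  \<open>(\<Sum>i. x\<^sub>i\<^sup>2) / 2 - (\<Sum>i<j. ln (x\<^sub>i - x\<^sub>j))\<close>.\<close>
lemma hermite_zeros_equilibrium:
  fixes z :: "real^'n"
  assumes zeros: "\<And>i. poly (hermite_poly CARD('n)) (z $ i) = 0"
    and inj: "inj (($) z)"
  shows "(\<Sum>j\<in>UNIV - {i}. 1 / (z $ i - z $ j)) = z $ i"
proof -
  let ?H = "hermite_poly CARD('n)"
  let ?L = "\<lambda>j. [:- (z $ j), 1:]"
  define Q where "Q = smult (2 ^ CARD('n)) (\<Prod>j\<in>UNIV - {i}. ?L j)"
  have degP: "degree (\<Prod>j\<in>UNIV. ?L j) = CARD('n)"
    by (subst degree_prod_eq_sum_degree) auto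
  \<comment> \<open>Both sides have degree at most \<open>CARD('n)\<close>, the same coefficient
    there, and agree at \<open>CARD('n)\<close> distinct points.\<close>
  have "?H = smult (2 ^ CARD('n)) (\<Prod>j\<in>UNIV. ?L j)"
  proof (rule poly_eqI_degree_lead_coeff[where n="CARD('n)" and A="range (($) z)"])
    have "coeff (\<Prod>j\<in>UNIV. ?L j) CARD('n) = 1"
      using lead_coeff_prod[of ?L UNIV] degP by simp
    then show "coeff ?H CARD('n) = coeff (smult (2 ^ CARD('n)) (\<Prod>j\<in>UNIV. ?L j)) CARD('n)"
      using hermite_poly_degree_coeff[of "CARD('n)"] by simp
    show "CARD('n) \<le> card (range (($) z))" by (simp add: card_image inj)
  qed (use zeros hermite_poly_degree_coeff degP in \<open>auto simp: poly_prod\<close>)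
  also have "(\<Prod>j\<in>UNIV. ?L j) = ?L i * (\<Prod>j\<in>UNIV - {i}. ?L j)"
    by (rule prod.remove) auto
  finally have H: "?H = ?L i * Q" by (simp add: Q_def)
  have nz: "z $ i - z $ j \<noteq> 0" if "j \<noteq> i" for j
    using inj that by (auto simp: inj_def)
  have Q_nz: "poly Q (z $ i) \<noteq> 0"
    using nz by (auto simp: Q_def poly_prod)
  have d1: "poly (pderiv ?H) (z $ i) = poly Q (z $ i)"
    by (simp add: H pderiv_mult pderiv_pCons del: mult_pCons_left)
  have d2: "poly (pderiv (pderiv ?H)) (z $ i) = 2 * poly (pderiv Q) (z $ i)"
    by (simp add: H pderiv_mult pderiv_add pderiv_pCons del: mult_pCons_left)
  \<comment> \<open>At a zero the undifferentiated term of the Hermite equation drops out. With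
    \<open>d1\<close> and \<open>d2\<close> this says that the logarithmic derivative of
    \<open>Q\<close> at \<open>z $ i\<close> is \<open>z $ i\<close>; as \<open>Q\<close> is a
    product of linear factors, that derivative is the sum of reciprocals.\<close>
  have ode: "poly (pderiv (pderiv ?H)) (z $ i) = 2 * z $ i * poly (pderiv ?H) (z $ i)"
    by (simp add: hermite_poly_ode zeros)
  have prod_eq: "(\<Prod>l\<in>UNIV - {i} - {j}. z $ i - z $ l) = (\<Prod>l\<in>UNIV - {i}. z $ i - z $ l) / (z $ i - z $ j)"
    if "j \<in> UNIV - {i}" for j
    using nz that by (subst (2) prod.remove[of _ j]) auto
  have "poly (pderiv Q) (z $ i) = 2 ^ CARD('n) * (\<Sum>j\<in>UNIV - {i}. \<Prod>l\<in>UNIV - {i} - {j}. z $ i - z $ l)"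
    by (simp add: Q_def pderiv_smult pderiv_prod poly_sum poly_prod pderiv_pCons)
  also have "\<dots> = poly Q (z $ i) * (\<Sum>j\<in>UNIV - {i}. 1 / (z $ i - z $ j))"
    by (simp add: Q_def poly_prod prod_eq sum_distrib_left)
  finally show ?thesis
    using ode Q_nz unfolding d1 d2 by simp
qed

text \<open>Links the pairs \<open>i < j\<close> indexing the density with the row sums over
  \<open>j \<noteq> i\<close> in the equilibrium relation and in the matrix.\<close>

lemma sum_ordered_pairs:
  fixes F :: "'n::{finite,linorder} \<Rightarrow> 'n \<Rightarrow> real"
  shows "(\<Sum>p\<in>{(i,j). i < j}. F (fst p) (snd p) + F (snd p) (fst p)) = (\<Sum>i\<in>UNIV. \<Sum>j\<in>UNIV - {i}. F i j)"
proof -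
  have "(\<Sum>i\<in>UNIV. \<Sum>j\<in>UNIV - {i}. F i j) = (\<Sum>p\<in>Sigma UNIV (\<lambda>i. UNIV - {i}). F (fst p) (snd p))"
    by (simp add: sum.Sigma case_prod_unfold)
  also have "Sigma UNIV (\<lambda>i::'n. UNIV - {i}) = {(i,j). i < j} \<union> {(i,j). j < i}"
    by (auto simp: neq_iff)
  also have "(\<Sum>p\<in>\<dots>. F (fst p) (snd p)) =
      (\<Sum>p\<in>{(i,j). i < j}. F (fst p) (snd p)) + (\<Sum>p\<in>{(i,j). j < i}. F (fst p) (snd p))"
    by (rule sum.union_disjoint) auto
  also have "(\<Sum>p\<in>{(i,j). j < i}. F (fst p) (snd p)) = (\<Sum>p\<in>{(i,j). i < j}. F (snd p) (fst p))"
    by (rule sum.reindex_bij_witness[of _ prod.swap prod.swap]) auto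
  finally show ?thesis by (simp add: sum.distrib)
qed

section \<open>Limit and bound for the factor of a single pair\<close>

text \<open>With \<open>c = sqrt (2 * k * t)\<close> the logarithm is
  \<open>2 * k * (ln (1 + u / c) - u / c)\<close>. Its leading Taylor term is
  \<open>- k * u\<^sup>2 / c\<^sup>2\<close>, which equals
  \<open>- u\<^sup>2 / (2 * t)\<close>.\<close>

lemma tendsto_powr_exp_factor:
  fixes u t :: real
  assumes "t > 0"
  shows "((\<lambda>k. ((1 + u / sqrt (2 * k * t))\<^sup>2) powr k * exp (- (2 * k * u / sqrt (2 * k * t)))) \<longlongrightarrow> exp (- (u\<^sup>2 / (2 * t)))) at_top"
proof -
  have "((\<lambda>k. 2 * k * ln (1 + u / sqrt (2 * k * t)) - 2 * k * u / sqrt (2 * k * t)) \<longlongrightarrow> - (u\<^sup>2 / (2 * t))) at_top"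
    using assms by (cases u "0::real" rule: linorder_cases; real_asymp simp: powr_half_sqrt field_simps power2_eq_square)
  then have "((\<lambda>k. exp (2 * k * ln (1 + u / sqrt (2 * k * t)) - 2 * k * u / sqrt (2 * k * t))) \<longlongrightarrow> exp (- (u\<^sup>2 / (2 * t)))) at_top"
    by (rule tendsto_exp)
  \<comment> \<open>For negative \<open>u\<close> the base may be negative at small
    \<open>k\<close>; the logarithm of its square is \<open>2 * ln (1 + u / c)\<close> only once the
    base is positive.\<close>
  moreover have "\<forall>\<^sub>F k in at_top. 1 + u / sqrt (2 * k * t) > 0"
    using assms by real_asymp
  then have "\<forall>\<^sub>F k in at_top. exp (2 * k * ln (1 + u / sqrt (2 * k * t)) - 2 * k * u / sqrt (2 * k * t))
     = ((1 + u / sqrt (2 * k * t))\<^sup>2) powr k * exp (- (2 * k * u / sqrt (2 * k * t)))"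
    by eventually_elim (simp add: powr_def ln_realpow mult_exp_exp algebra_simps)
  ultimately show ?thesis
    by (simp cong: tendsto_cong)
qed

lemma powr_exp_factor_le_1:
  fixes v k :: real
  assumes "-1 \<le> v" "0 \<le> k"
  shows "((1 + v)\<^sup>2) powr k * exp (- (2 * k * v)) \<le> 1"
proof -
  have "(1 + v)\<^sup>2 \<le> (exp v)\<^sup>2"
    using assms exp_ge_add_one_self[of v] by (intro power_mono) auto
  then have "((1 + v)\<^sup>2) powr k \<le> ((exp v)\<^sup>2) powr k"
    using assms by (intro powr_mono2) auto
  also have "\<dots> = exp (2 * k * v)"
    by (simp add: powr_def ln_realpow)
  finally show ?thesis
    by (simp add: exp_minus field_simps)
qed

lemma matrix_inv_eqI:
  fixes A :: "real^'n^'n"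
  assumes "A ** B = mat 1" "B ** A = mat 1"
  shows "matrix_inv A = B"
proof -
  have "A ** matrix_inv A = mat 1 \<and> matrix_inv A ** A = mat 1"
    unfolding matrix_inv_def by (rule someI[of _ B]) (use assms in blast)
  then show ?thesis
    by (metis assms(2) matrix_mul_assoc matrix_mul_lid matrix_mul_rid)
qed

section \<open>The rescaled density\<close>

text \<open>The quantity \<open>u\<close> of the introduction, for the pair
  \<open>p\<close>.\<close>

definition gap_ratio :: "real^'n \<Rightarrow> real^'n \<Rightarrow> 'n \<times> 'n \<Rightarrow> real" where
  "gap_ratio z y p = (y $ fst p - y $ snd p) / (z $ fst p - z $ snd p)"

text \<open>The translated density without its constant. The linear term of the Gaussian is
  distributed over the pairs, so that each pair factor, and not only their product, is bounded by 1
  on the chamber.\<close>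

definition shifted_weight :: "real^'n::{finite,linorder} \<Rightarrow> real \<Rightarrow> real \<Rightarrow> real^'n::_ \<Rightarrow> real" where
  "shifted_weight z t k y = (let c = sqrt (2 * k * t) in
     indicator weyl_chamber_A (y + c *\<^sub>R z) * exp (- (norm y)\<^sup>2 / (2 * t)) *
     (\<Prod>p\<in>{(i,j). i < j}. ((1 + gap_ratio z y p / c)\<^sup>2) powr k * exp (- (2 * k * gap_ratio z y p / c))))"

lemma measurable_weyl_chamber_A [measurable]:
  "(weyl_chamber_A :: (real^'n::{finite,linorder}) set) \<in> sets borel"
proof -
  have "closed (weyl_chamber_A :: (real^'n::_) set)"
    unfolding weyl_chamber_A_def
    by (intro closed_Collect_all closed_Collect_imp closed_Collect_le open_Collect_const continuous_intros)
  then show ?thesis by simp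
qed

lemma measurable_bessel_A_weight [measurable]:
  "(bessel_A_weight t k :: real^'n::{finite,linorder} \<Rightarrow> real) \<in> borel_measurable borel"
  unfolding bessel_A_weight_def[abs_def] by measurable

lemma measurable_shifted_weight [measurable]: "shifted_weight z t k \<in> borel_measurable borel"
  unfolding shifted_weight_def[abs_def] gap_ratio_def Let_def by measurable

lemma bessel_A_weight_nonneg: "0 \<le> bessel_A_weight t k y"
  unfolding bessel_A_weight_def by (intro mult_nonneg_nonneg prod_nonneg) auto

lemma lborel_integral_translate:
  fixes f :: "'a::euclidean_space \<Rightarrow> real"
  assumes "f \<in> borel_measurable borel"
  shows "(\<integral>x. f (x + a) \<partial>lborel) = (\<integral>x. f x \<partial>lborel)"
proof -
  have "(\<integral>x. f x \<partial>lborel) = (\<integral>x. f x \<partial>distr lborel borel ((+) a))"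
    by (simp add: lborel_distr_plus)
  also have "\<dots> = (\<integral>x. f (a + x) \<partial>lborel)"
    using assms by (intro integral_distr) auto
  finally show ?thesis by (simp add: add.commute)
qed

text \<open>The constant \<open>K\<close> cancels between the integrand and the normalising
  integral. If that integral is 0, both sides are 0 by the convention for division by 0.\<close>

lemma integral_shifted_bessel_A_law:
  fixes f :: "real^'n::{finite,linorder} \<Rightarrow> real"
  assumes [measurable]: "f \<in> borel_measurable borel"
    and eq: "\<And>y. bessel_A_weight t k (y + a) = K * g y" and K: "K \<noteq> 0"
  shows "(\<integral>x. f x \<partial>distr (bessel_A_law t k) borel (\<lambda>x. x - a))
       = (\<integral>y. g y * f y \<partial>lborel) / (\<integral>y. g y \<partial>lborel)"
proof -
  let ?w = "bessel_A_weight t k :: real^'n::_ \<Rightarrow> real"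
  let ?I = "integral\<^sup>L lborel ?w"
  have I: "?I = K * (\<integral>y. g y \<partial>lborel)"
    using lborel_integral_translate[of ?w a] by (simp add: eq)
  have nonneg: "0 \<le> ?w x / ?I" for x
    by (intro divide_nonneg_nonneg Bochner_Integration.integral_nonneg bessel_A_weight_nonneg)
  have "(\<integral>x. f x \<partial>distr (bessel_A_law t k) borel (\<lambda>x. x - a)) = (\<integral>x. f (x - a) \<partial>bessel_A_law t k)"
    by (rule integral_distr) (auto simp: bessel_A_law_def)
  also have "\<dots> = (\<integral>x. (?w x / ?I) * f (x - a) \<partial>lborel)"
    unfolding bessel_A_law_def
    by (rule integral_real_density) (simp, rule AE_I2, rule nonneg, simp)
  also have "\<dots> = (\<integral>y. (?w (y + a) / ?I) * f (y + a - a) \<partial>lborel)"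
    by (rule lborel_integral_translate[symmetric]) measurable
  also have "\<dots> = (\<integral>y. (K / ?I) * (g y * f y) \<partial>lborel)"
    by (rule Bochner_Integration.integral_cong) (simp_all add: eq)
  also have "\<dots> = (\<integral>y. g y * f y \<partial>lborel) / (\<integral>y. g y \<partial>lborel)"
    using K by (simp add: I)
  finally show ?thesis .
qed

text \<open>Supplies the majorant for dominated convergence.\<close>

lemma integrable_gaussian_scaled:
  assumes "t > 0"
  shows "integrable lborel (\<lambda>y::real^'n. exp (- (norm y)\<^sup>2 / (2 * t)))"
proof -
  let ?A = "(1 / t) *\<^sub>R mat 1 :: real^'n^'n"
  have Ax: "?A *v x = (1 / t) *\<^sub>R x" for x
    by (simp flip: scaleR_matrix_vector_assoc)
  have "(\<integral>\<^sup>+y. ennreal (exp (- (y \<bullet> (?A *v y)) / 2)) \<partial>lborel) < \<infinity>"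
    by (subst nn_integral_gaussian) (use assms in \<open>auto simp: Ax transpose_scalar\<close>)
  also have "(\<lambda>y. exp (- (y \<bullet> (?A *v y)) / 2)) = (\<lambda>y. exp (- (norm y)\<^sup>2 / (2 * t)))"
    by (simp add: Ax power2_norm_eq_inner mult.commute)
  finally show ?thesis
    by (intro integrableI_nonneg) auto
qed

lemma det_scaleR:
  fixes A :: "real^'n^'n"
  shows "det (c *\<^sub>R A) = c ^ CARD('n) * det A"
  by (simp add: det_def prod.distrib sum_distrib_left mult_ac)

section \<open>Convergence for a strictly decreasing equilibrium configuration\<close>

text \<open>The limit uses the Hermite zeros only through their order and the equilibrium relation,
  so these two properties are isolated here.\<close>

locale stieltjes_equilibrium =
  fixes z :: "real^'n::{finite,linorder}" and t :: real
  assumes decr: "i < j \<Longrightarrow> z $ j < z $ i"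
    and equilibrium: "(\<Sum>j\<in>UNIV - {i}. 1 / (z $ i - z $ j)) = z $ i"
    and t_pos: "t > 0"
begin

text \<open>The point where equilibrium enters: the first-order terms of the pair factors add up to
  the cross term of the shifted Gaussian.\<close>

lemma sum_gap_ratio: "(\<Sum>p\<in>{(i,j). i < j}. gap_ratio z y p) = y \<bullet> z"
proof -
  have "(\<Sum>p\<in>{(i,j). i < j}. gap_ratio z y p) =
    (\<Sum>p\<in>{(i,j). i < j}. y $ fst p / (z $ fst p - z $ snd p) + y $ snd p / (z $ snd p - z $ fst p))"
    by (intro sum.cong refl) (auto simp: gap_ratio_def minus_divide_right diff_divide_distrib)
  also have "\<dots> = (\<Sum>i\<in>UNIV. \<Sum>j\<in>UNIV - {i}. y $ i / (z $ i - z $ j))"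
    by (rule sum_ordered_pairs)
  also have "\<dots> = (\<Sum>i\<in>UNIV. y $ i * (\<Sum>j\<in>UNIV - {i}. 1 / (z $ i - z $ j)))"
    by (simp add: sum_distrib_left)
  also have "\<dots> = y \<bullet> z" by (simp add: equilibrium inner_vec_def)
  finally show ?thesis .
qed

text \<open>The Hessian at \<open>z\<close> of the energy whose critical points satisfy the
  equilibrium relation.\<close>

definition S :: "real^'n::_^'n::_" where
  "S = (\<chi> i j. if i = j then 1 + (\<Sum>l\<in>UNIV - {i}. 1 / (z $ i - z $ l)\<^sup>2)
                             else - (1 / (z $ i - z $ j)\<^sup>2))"

lemma S_sym: "transpose S = S"
  by (simp add: S_def transpose_def vec_eq_iff power2_commute)

text \<open>Row \<open>i\<close> of \<open>S *v y\<close> involves only \<open>y $ i\<close> and the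
  differences \<open>y $ i - y $ j\<close>; adding the contributions of \<open>(i,j)\<close> and
  \<open>(j,i)\<close> completes a square. This yields positive definiteness and identifies the
  limiting exponent.\<close>

lemma S_quadratic: "y \<bullet> (S *v y) = (norm y)\<^sup>2 + (\<Sum>p\<in>{(i,j). i < j}. (gap_ratio z y p)\<^sup>2)"
proof -
  have row: "(S *v y) $ i = y $ i + (\<Sum>j\<in>UNIV - {i}. (y $ i - y $ j) / (z $ i - z $ j)\<^sup>2)" for i
  proof -
    have "(S *v y) $ i = S $ i $ i * y $ i + (\<Sum>j\<in>UNIV - {i}. S $ i $ j * y $ j)"
      by (simp add: matrix_vector_mult_def sum.remove[of UNIV i])
    also have "(\<Sum>j\<in>UNIV - {i}. S $ i $ j * y $ j) = (\<Sum>j\<in>UNIV - {i}. - (y $ j / (z $ i - z $ j)\<^sup>2))"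
      by (intro sum.cong) (auto simp: S_def)
    also have "S $ i $ i * y $ i = y $ i + (\<Sum>j\<in>UNIV - {i}. y $ i / (z $ i - z $ j)\<^sup>2)"
      by (simp add: S_def algebra_simps sum_distrib_left)
    finally show ?thesis
      by (simp add: diff_divide_distrib sum_subtractf sum_negf)
  qed
  have "y \<bullet> (S *v y) = (\<Sum>i\<in>UNIV. y $ i * y $ i) + (\<Sum>i\<in>UNIV. \<Sum>j\<in>UNIV - {i}. y $ i * (y $ i - y $ j) / (z $ i - z $ j)\<^sup>2)"
    by (simp add: inner_vec_def row distrib_left sum.distrib sum_distrib_left)
  also have "(\<Sum>i\<in>UNIV. \<Sum>j\<in>UNIV - {i}. y $ i * (y $ i - y $ j) / (z $ i - z $ j)\<^sup>2)
     = (\<Sum>p\<in>{(i,j). i < j}. y $ fst p * (y $ fst p - y $ snd p) / (z $ fst p - z $ snd p)\<^sup>2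
         + y $ snd p * (y $ snd p - y $ fst p) / (z $ snd p - z $ fst p)\<^sup>2)"
    by (rule sum_ordered_pairs[symmetric])
  also have "\<dots> = (\<Sum>p\<in>{(i,j). i < j}. (gap_ratio z y p)\<^sup>2)"
  proof (intro sum.cong refl)
    fix p :: "'n \<times> 'n"
    have "(z $ snd p - z $ fst p)\<^sup>2 = (z $ fst p - z $ snd p)\<^sup>2" by (rule power2_commute)
    then show "y $ fst p * (y $ fst p - y $ snd p) / (z $ fst p - z $ snd p)\<^sup>2
         + y $ snd p * (y $ snd p - y $ fst p) / (z $ snd p - z $ fst p)\<^sup>2 = (gap_ratio z y p)\<^sup>2"
      by (simp add: gap_ratio_def power_divide flip: add_divide_distrib) (simp add: power2_eq_square algebra_simps)
  qed
  finally show ?thesis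
    by (simp add: power2_norm_eq_inner inner_vec_def)
qed

lemma measurable_S_quadratic [measurable]: "(\<lambda>y. y \<bullet> (S *v y)) \<in> borel_measurable borel"
  by (intro borel_measurable_continuous_onI continuous_intros)

lemma S_pos: "y \<noteq> 0 \<Longrightarrow> 0 < y \<bullet> (S *v y)"
  unfolding S_quadratic by (intro add_pos_nonneg sum_nonneg) auto

lemma bessel_A_weight_shift:
  assumes "k > 0"
  obtains K where "K \<noteq> 0" "\<And>y. bessel_A_weight t k (y + sqrt (2 * k * t) *\<^sub>R z) = K * shifted_weight z t k y"
proof
  define c where "c = sqrt (2 * k * t)"
  have c: "c > 0" "c\<^sup>2 = 2 * k * t"
    using assms t_pos by (auto simp: c_def)
  let ?P = "{(i,j). i < j} :: ('n \<times> 'n) set"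
  let ?d = "\<lambda>p. z $ fst p - z $ snd p"
  \<comment> \<open>The value of the weight at \<open>c *\<^sub>R z\<close>, that is, at
    \<open>y = 0\<close>.\<close>
  let ?K = "exp (- (c\<^sup>2 * (norm z)\<^sup>2) / (2 * t)) * (\<Prod>p\<in>?P. ((c * ?d p)\<^sup>2) powr k)"
  have d: "?d p > 0" if "p \<in> ?P" for p
    using that decr by auto
  show "?K \<noteq> 0"
    using c d by force
  fix y
  have pair: "(((y + c *\<^sub>R z) $ fst p - (y + c *\<^sub>R z) $ snd p)\<^sup>2) powr k
      = ((c * ?d p)\<^sup>2) powr k * ((1 + gap_ratio z y p / c)\<^sup>2) powr k" if "p \<in> ?P" for p
  proof -
    have "(y + c *\<^sub>R z) $ fst p - (y + c *\<^sub>R z) $ snd p = (c * ?d p) * (1 + gap_ratio z y p / c)"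
      using d[OF that] c by (simp add: gap_ratio_def field_simps)
    then show ?thesis by (simp add: power_mult_distrib powr_mult)
  qed
  \<comment> \<open>The choice of scale \<open>c\<close> makes the coefficient of the pair exponents
    match that of the Gaussian cross term.\<close>
  have lin: "2 * k / c = c / t"
    using c t_pos by (simp add: field_simps power2_eq_square)
  have "(\<Prod>p\<in>?P. exp (- (2 * k * gap_ratio z y p / c))) = exp (- (c / t * (y \<bullet> z)))"
    by (simp add: sum_gap_ratio[symmetric] lin[symmetric] sum_distrib_left sum_negf flip: exp_sum)
  then have "exp (- (norm y)\<^sup>2 / (2 * t)) * (\<Prod>p\<in>?P. exp (- (2 * k * gap_ratio z y p / c)))
      = exp (- (norm y)\<^sup>2 / (2 * t) - c / t * (y \<bullet> z))"
    by (simp add: mult_exp_exp)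
  moreover have "(norm (y + c *\<^sub>R z))\<^sup>2 = (norm y)\<^sup>2 + 2 * c * (y \<bullet> z) + c\<^sup>2 * (norm z)\<^sup>2"
    unfolding power2_norm_eq_inner by (simp add: inner_simps inner_commute power2_eq_square algebra_simps)
  then have "exp (- (norm (y + c *\<^sub>R z))\<^sup>2 / (2 * t)) =
      exp (- (c\<^sup>2 * (norm z)\<^sup>2) / (2 * t)) * exp (- (norm y)\<^sup>2 / (2 * t) - c / t * (y \<bullet> z))"
    using t_pos by (simp add: mult_exp_exp field_simps)
  ultimately have ex: "exp (- (norm (y + c *\<^sub>R z))\<^sup>2 / (2 * t)) =
      exp (- (c\<^sup>2 * (norm z)\<^sup>2) / (2 * t)) * exp (- (norm y)\<^sup>2 / (2 * t)) *
       (\<Prod>p\<in>?P. exp (- (2 * k * gap_ratio z y p / c)))"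
    by (simp only: mult.assoc)
  show "bessel_A_weight t k (y + sqrt (2 * k * t) *\<^sub>R z) = ?K * shifted_weight z t k y"
    unfolding bessel_A_weight_def shifted_weight_def Let_def c_def[symmetric]
    by (simp only: prod.cong[OF refl pair] prod.distrib ex) (simp only: mult_ac)
qed

lemma shifted_weight_bounds:
  assumes "k > 0"
  shows "0 \<le> shifted_weight z t k y" "shifted_weight z t k y \<le> exp (- (norm y)\<^sup>2 / (2 * t))"
proof -
  define c where "c = sqrt (2 * k * t)"
  have c: "c > 0" using assms t_pos by (auto simp: c_def)
  let ?P = "{(i,j). i < j} :: ('n \<times> 'n) set"
  let ?F = "\<lambda>p. ((1 + gap_ratio z y p / c)\<^sup>2) powr k * exp (- (2 * k * gap_ratio z y p / c))"
  show "0 \<le> shifted_weight z t k y"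
    unfolding shifted_weight_def Let_def by (intro mult_nonneg_nonneg prod_nonneg) auto
  have "(\<Prod>p\<in>?P. ?F p) \<le> 1" if W: "y + c *\<^sub>R z \<in> weyl_chamber_A"
  proof (intro prod_le_1 conjI)
    fix p assume p: "p \<in> ?P"
    then have d: "z $ fst p - z $ snd p > 0" using decr by auto
    \<comment> \<open>The chamber inequality for \<open>p\<close> says that \<open>c\<close> times
      the gap of \<open>z\<close>, times \<open>1 + gap_ratio z y p / c\<close>, is nonnegative. Off
      the chamber the indicator makes the weight 0.\<close>
    have "(y + c *\<^sub>R z) $ snd p \<le> (y + c *\<^sub>R z) $ fst p"
      using W p by (auto simp: weyl_chamber_A_def)
    then have "- 1 \<le> gap_ratio z y p / c"
      using d c by (simp add: gap_ratio_def field_simps)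
    then show "?F p \<le> 1"
      using powr_exp_factor_le_1[of "gap_ratio z y p / c" k] assms by simp
  qed simp
  then show "shifted_weight z t k y \<le> exp (- (norm y)\<^sup>2 / (2 * t))"
    unfolding shifted_weight_def Let_def c_def[symmetric]
    by (auto simp: indicator_def)
qed

lemma shifted_weight_tendsto:
  "((\<lambda>k. shifted_weight z t k y) \<longlongrightarrow> exp (- (y \<bullet> (S *v y)) / (2 * t))) at_top"
proof -
  let ?P = "{(i,j). i < j} :: ('n \<times> 'n) set"
  \<comment> \<open>The gaps of \<open>z\<close> are strictly positive, so for fixed
    \<open>y\<close> the growing shift eventually dominates in each of the finitely many pairs and
    the indicator becomes 1.\<close>
  have "\<forall>\<^sub>F k in at_top. y $ j - y $ i \<le> sqrt (2 * k * t) * (z $ i - z $ j)" if "i < j" for i j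
    using decr[OF that] t_pos by real_asymp
  then have "\<forall>\<^sub>F k in at_top. \<forall>i j. i < j \<longrightarrow> y $ j - y $ i \<le> sqrt (2 * k * t) * (z $ i - z $ j)"
    by (simp add: eventually_ball_finite_distrib[of UNIV, simplified])
  then have "\<forall>\<^sub>F k in at_top. y + sqrt (2 * k * t) *\<^sub>R z \<in> weyl_chamber_A"
    by eventually_elim (auto simp: weyl_chamber_A_def le_less algebra_simps)
  then have "\<forall>\<^sub>F k in at_top. indicator weyl_chamber_A (y + sqrt (2 * k * t) *\<^sub>R z) = (1::real)"
    by eventually_elim simp
  then have "((\<lambda>k. indicator weyl_chamber_A (y + sqrt (2 * k * t) *\<^sub>R z) :: real) \<longlongrightarrow> 1) at_top"
    by (rule tendsto_eventually)
  then have "((\<lambda>k. shifted_weight z t k y) \<longlongrightarrow>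
     1 * exp (- (norm y)\<^sup>2 / (2 * t)) * (\<Prod>p\<in>?P. exp (- ((gap_ratio z y p)\<^sup>2 / (2 * t))))) at_top"
    unfolding shifted_weight_def Let_def
    by (intro tendsto_mult tendsto_prod tendsto_const tendsto_powr_exp_factor t_pos)
  also have "1 * exp (- (norm y)\<^sup>2 / (2 * t)) * (\<Prod>p\<in>?P. exp (- ((gap_ratio z y p)\<^sup>2 / (2 * t))))
     = exp (- (y \<bullet> (S *v y)) / (2 * t))"
    by (simp add: S_quadratic mult_exp_exp sum_negf add_divide_distrib diff_divide_distrib flip: exp_sum sum_divide_distrib)
  finally show ?thesis .
qed

lemma integral_shifted_weight_tendsto:
  assumes "continuous_on UNIV f" "bounded (range f)"
  shows "((\<lambda>k. \<integral>y. shifted_weight z t k y * f y \<partial>lborel) \<longlongrightarrow>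
          (\<integral>y. exp (- (y \<bullet> (S *v y)) / (2 * t)) * f y \<partial>lborel)) at_top"
proof -
  obtain C where C: "\<And>y. \<bar>f y\<bar> \<le> C"
    using assms(2) by (auto simp: bounded_iff)
  have [measurable]: "f \<in> borel_measurable borel"
    by (rule borel_measurable_continuous_onI) fact
  show ?thesis
  proof (rule integral_dominated_convergence_at_top[where w="\<lambda>y. exp (- (norm y)\<^sup>2 / (2 * t)) * C"])
    show "integrable lborel (\<lambda>y::real^'n::_. exp (- (norm y)\<^sup>2 / (2 * t)) * C)"
      by (intro integrable_mult_left integrable_gaussian_scaled t_pos)
    show "AE y in lborel. ((\<lambda>k. shifted_weight z t k y * f y) \<longlongrightarrow> exp (- (y \<bullet> (S *v y)) / (2 * t)) * f y) at_top"
      by (intro AE_I2 tendsto_mult shifted_weight_tendsto tendsto_const)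
    show "\<forall>\<^sub>F k in at_top. AE y in lborel. norm (shifted_weight z t k y * f y) \<le> exp (- (norm y)\<^sup>2 / (2 * t)) * C"
      using eventually_gt_at_top[of 0]
    proof eventually_elim
      case (elim k)
      show ?case
        using shifted_weight_bounds[OF elim] C by (intro AE_I2) (auto simp: abs_mult intro!: mult_mono)
    qed
  qed measurable
qed

section \<open>The limiting normal law and weak convergence\<close>

lemma det_S: "0 < det S"
  using det_posdef[OF S_sym S_pos] .

lemma invertible_S: "invertible S"
  using det_S by (simp add: invertible_det_nz)

lemma S_inv: "S ** matrix_inv S = mat 1" "matrix_inv S ** S = mat 1"
  using invertible_S matrix_inv_eqI unfolding invertible_def by metis+

lemma det_inv_S: "det (matrix_inv S) = 1 / det S"
  using arg_cong[OF S_inv(1), of det] det_S by (simp add: det_mul field_simps)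

lemma integral_limit_gaussian:
  "(\<integral>y. exp (- (y \<bullet> (S *v y)) / (2 * t)) \<partial>lborel) = sqrt ((2 * pi) ^ CARD('n) * det (t *\<^sub>R matrix_inv S))"
proof -
  let ?A = "(1 / t) *\<^sub>R S"
  have Ax: "?A *v x = (1 / t) *\<^sub>R (S *v x)" for x
    by (simp flip: scaleR_matrix_vector_assoc)
  have sym: "transpose ?A = ?A" by (simp add: transpose_scalar S_sym)
  have pos: "0 < y \<bullet> (?A *v y)" if "y \<noteq> 0" for y
    using S_pos[OF that] t_pos by (simp add: Ax)
  have det: "det (t *\<^sub>R matrix_inv S) = 1 / det ?A"
    using t_pos by (simp add: det_scaleR det_inv_S field_simps)
  have "(\<integral>y. exp (- (y \<bullet> (?A *v y)) / 2) \<partial>lborel) = enn2real (\<integral>\<^sup>+y. exp (- (y \<bullet> (?A *v y)) / 2) \<partial>lborel)"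
    unfolding Ax by (rule integral_eq_nn_integral) auto
  also have "(\<integral>\<^sup>+y. exp (- (y \<bullet> (?A *v y)) / 2) \<partial>lborel) = ennreal (sqrt ((2 * pi) ^ CARD('n) / det ?A))"
    by (rule nn_integral_gaussian[OF sym pos])
  also have "enn2real \<dots> = sqrt ((2 * pi) ^ CARD('n) / det ?A)"
    using det_posdef[OF sym pos] by simp
  finally show ?thesis
    by (simp add: Ax det mult.commute)
qed

text \<open>Replaces the explicit normalising constant by the integral it equals, so that the limit
  has the same quotient form as \<open>integral_shifted_bessel_A_law\<close>.\<close>

lemma integral_normal_vec_law:
  assumes [measurable]: "f \<in> borel_measurable borel"
  shows "(\<integral>x. f x \<partial>normal_vec_law (t *\<^sub>R matrix_inv S)) =
    (\<integral>y. exp (- (y \<bullet> (S *v y)) / (2 * t)) * f y \<partial>lborel) / (\<integral>y. exp (- (y \<bullet> (S *v y)) / (2 * t)) \<partial>lborel)"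
proof -
  have "matrix_inv (t *\<^sub>R matrix_inv S) = (1 / t) *\<^sub>R S"
    using t_pos by (intro matrix_inv_eqI) (simp_all add: S_inv scalar_matrix_assoc matrix_scalar_ac flip: scalar_matrix_assoc)
  then have q: "- (x \<bullet> (matrix_inv (t *\<^sub>R matrix_inv S) *v x)) / 2 = - (x \<bullet> (S *v x)) / (2 * t)" for x
    by (simp flip: scaleR_matrix_vector_assoc)
  show ?thesis
    unfolding normal_vec_law_def q integral_limit_gaussian[symmetric]
    by (subst integral_density) (auto intro!: divide_nonneg_nonneg Bochner_Integration.integral_nonneg)
qed

lemma weak_conv_shifted_bessel_A_law:
  "weak_conv_along at_top
     (\<lambda>k. distr (bessel_A_law t k) borel (\<lambda>x. x - sqrt (2 * k * t) *\<^sub>R z))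
     (normal_vec_law (t *\<^sub>R matrix_inv S))"
  unfolding weak_conv_along_def
proof (intro allI impI, elim conjE)
  fix f :: "real^'n::_ \<Rightarrow> real"
  assume f: "continuous_on UNIV f" "bounded (range f)"
  then have meas [measurable]: "f \<in> borel_measurable borel"
    by (intro borel_measurable_continuous_onI)
  \<comment> \<open>The constant test function 1 gives convergence of the normalising integrals;
    their limit is nonzero, so the quotients converge.\<close>
  have "((\<lambda>k. \<integral>y. shifted_weight z t k y * 1 \<partial>lborel) \<longlongrightarrow>
          (\<integral>y. exp (- (y \<bullet> (S *v y)) / (2 * t)) * 1 \<partial>lborel)) at_top"
    by (rule integral_shifted_weight_tendsto) auto
  moreover have "0 < det (t *\<^sub>R matrix_inv S)"
    using t_pos det_inv_S det_S by (simp add: det_scaleR)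
  then have "(\<integral>y. exp (- (y \<bullet> (S *v y)) / (2 * t)) \<partial>lborel) \<noteq> 0"
    unfolding integral_limit_gaussian by simp
  ultimately have "((\<lambda>k. (\<integral>y. shifted_weight z t k y * f y \<partial>lborel) / (\<integral>y. shifted_weight z t k y \<partial>lborel))
     \<longlongrightarrow> (\<integral>x. f x \<partial>normal_vec_law (t *\<^sub>R matrix_inv S))) at_top"
    unfolding integral_normal_vec_law[OF meas]
    by (intro tendsto_divide integral_shifted_weight_tendsto f) auto
  moreover have "\<forall>\<^sub>F k in at_top. (\<integral>y. shifted_weight z t k y * f y \<partial>lborel) / (\<integral>y. shifted_weight z t k y \<partial>lborel)
     = (\<integral>x. f x \<partial>distr (bessel_A_law t k) borel (\<lambda>x. x - sqrt (2 * k * t) *\<^sub>R z))"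
    using eventually_gt_at_top[of 0]
  proof eventually_elim
    case (elim k)
    then obtain K where "K \<noteq> 0"
      "\<And>y. bessel_A_weight t k (y + sqrt (2 * k * t) *\<^sub>R z) = K * shifted_weight z t k y"
      by (rule bessel_A_weight_shift) blast
    from integral_shifted_bessel_A_law[OF meas this(2,1)] show ?case by simp
  qed
  ultimately show "((\<lambda>k. \<integral>x. f x \<partial>distr (bessel_A_law t k) borel (\<lambda>x. x - sqrt (2 * k * t) *\<^sub>R z))
     \<longlongrightarrow> (\<integral>x. f x \<partial>normal_vec_law (t *\<^sub>R matrix_inv S))) at_top"
    by (rule Lim_transform_eventually)
qed

end

theorem theorem2p2:
  fixes z :: "real ^ 'n::{finite,linorder}" and t :: real
    and S :: "real ^ 'n::{finite,linorder} ^ 'n::{finite,linorder}"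
  assumes zeros: "\<forall>i. poly (hermite_poly CARD('n)) (z $ i) = 0"
    and decr: "\<forall>i j. i < j \<longrightarrow> z $ j < z $ i"
    and S_def: "S = (\<chi> i j. if i = j then 1 + (\<Sum>l\<in>UNIV - {i}. 1 / (z $ i - z $ l)\<^sup>2)
                             else - (1 / (z $ i - z $ j)\<^sup>2))"
    and t_pos: "t > 0"
  shows "invertible S \<and>
         weak_conv_along at_top
           (\<lambda>k. distr (bessel_A_law t k) borel (\<lambda>x. x - sqrt (2 * k * t) *\<^sub>R z))
           (normal_vec_law (t *\<^sub>R matrix_inv S))"
proof -
  \<comment> \<open>Distinctness makes these zeros all the zeros of the Hermite polynomial, as its
    factorisation requires.\<close>
  have "inj (($) z)"
    using decr by (intro injI) (metis less_irrefl neq_iff)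
  then interpret stieltjes_equilibrium z t
    using zeros decr t_pos by unfold_locales (auto intro: hermite_zeros_equilibrium)
  have "S = local.S" unfolding assms(3) S_def ..
  then show ?thesis
    using invertible_S weak_conv_shifted_bessel_A_law by simp
qed

end
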